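(* Let $G$ be a finite simple graph and let $\bm{\lambda}=(\lambda_v)_{v\in V(G)}\in(\mathbb{R}_{\ge 0})^{V(G)}$. Write $d_v\coloneqq\deg_G(v)$. Then \[ Z_G(\bm{\lambda})\ \ge\ \prod_{v\in V(G)} Z_{K_{d_v+1}}(\lambda_v)^{\frac{1}{d_v+1}}=\prod_{v\in V(G)}\bigl((d_v+1)\lambda_v+1\bigr)^{\frac{1}{d_v+1}}. \] Moreover, equality holds if and only if for each connected component $C$ of $G$, either $\lambda_v=0$ for all $v\in C$, or $\lambda_v$ is constant on $C$ and $G[C]$ is a clique.
   Context: $\mathcal{I}(G)$ denotes the set of all independent sets of $G$ (including the empty set). The multivariate independence polynomial is $Z_G(\bm{\lambda})\coloneqq\sum_{I\in\mathcal{I}(G)}\prod_{v\in I}\lambda_v$, and $Z_G(\lambda)\coloneqq Z_G(\lambda,\dots,\lambda)$; $K_m$ is the complete graph on $m$ vertices, so $Z_{K_m}(\lambda)=1+m\lambda$. *)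

theory Defs
  imports Complex_Main "Graph_Theory.Graph_Theory"
begin

text \<open>
  A finite simple graph is a \<open>Digraph.graph\<close>: a finite, loop-free, symmetric digraph
  without parallel arcs, so that an undirected edge is a pair of opposite arcs. Hence the degree of
  a vertex is its \<open>out_degree\<close>, and the vertex sets of the connected components are the
  strongly connected classes \<open>sccs_verts\<close>. The name is qualified because
  \<open>Map.graph\<close> also exists.
\<close>

definition indep_sets :: "('a, 'b) pre_digraph \<Rightarrow> 'a set set" where
  "indep_sets G = {I. I \<subseteq> verts G \<and> (\<forall>u\<in>I. \<forall>v\<in>I. (u, v) \<notin> arcs_ends G)}"

definition indep_poly :: "('a, 'b) pre_digraph \<Rightarrow> ('a \<Rightarrow> real) \<Rightarrow> real" where
  "indep_poly G l = (\<Sum>I\<in>indep_sets G. \<Prod>v\<in>I. l v)"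

definition indep_poly_univ :: "('a, 'b) pre_digraph \<Rightarrow> real \<Rightarrow> real" where
  "indep_poly_univ G x = indep_poly G (\<lambda>_. x)"

definition complete_graph :: "nat \<Rightarrow> (nat, nat \<times> nat) pre_digraph" where
  "complete_graph m =
    \<lparr>verts = {..<m}, arcs = {(u, v). u < m \<and> v < m \<and> u \<noteq> v}, tail = fst, head = snd\<rparr>"

lemma arcs_ends_complete_graph:
  "arcs_ends (complete_graph m) = {(u, v). u < m \<and> v < m \<and> u \<noteq> v}"
  by (auto simp: arcs_ends_def arc_to_ends_def complete_graph_def)

lemma complete_digraph_complete_graph: "complete_digraph m (complete_graph m)"
proof -
  have fin: "finite {(u, v). u < m \<and> v < m \<and> u \<noteq> v}"
    by (rule finite_subset[of _ "{..<m} \<times> {..<m}"]) auto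
  have "Digraph.graph (complete_graph m)"
    using fin
    by unfold_locales
      (auto simp: complete_graph_def arc_to_ends_def symmetric_def arcs_ends_def sym_def image_iff)
  then show ?thesis
    unfolding complete_digraph_def arcs_ends_complete_graph
    by (auto simp: complete_graph_def)
qed

lemma indep_poly_univ_complete_graph:
  "indep_poly_univ (complete_graph m) x = 1 + real m * x"
proof -
  have eq: "indep_sets (complete_graph m) = insert {} ((\<lambda>v. {v}) ` {..<m})" (is "?L = ?R")
  proof
    show "?L \<subseteq> ?R"
    proof
      fix I assume I: "I \<in> ?L"
      then have "I \<subseteq> {..<m}" "\<And>u v. u \<in> I \<Longrightarrow> v \<in> I \<Longrightarrow> u = v"
        unfolding indep_sets_def arcs_ends_complete_graph
        by (auto simp: complete_graph_def)
      then show "I \<in> ?R" by (cases "I = {}") (auto, blast)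
    qed
    show "?R \<subseteq> ?L"
      unfolding indep_sets_def arcs_ends_complete_graph by (auto simp: complete_graph_def)
  qed
  have "(\<Sum>I\<in>(\<lambda>v. {v}) ` {..<m}. \<Prod>v\<in>I. x) = (\<Sum>v<m. x)"
    by (subst sum.reindex) (auto simp: inj_on_def)
  then show ?thesis
    unfolding indep_poly_univ_def indep_poly_def eq
    by (subst sum.insert) auto
qed

end

theory Submission
  imports Defs
begin

text \<open>
  Induct on the number of vertices by deleting a vertex \<open>v\<close> of maximum degree \<open>m - 1\<close>, using
  \<open>Z\<^sub>G = Z\<^sub>G\<^sub>-\<^sub>v + \<lambda>\<^sub>v Z\<^sub>G\<^sub>-\<^sub>N\<^sub>[\<^sub>v\<^sub>]\<close>. With \<open>f\<^sub>k(x) = (1 + k x)\<^bsup>1/k\<^esup>\<close>, which decreases in \<open>k\<close>, the factors of the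
  vertices outside the closed neighbourhood cancel, and what remains is the inequality
  \<open>f\<^sub>m(\<lambda>\<^sub>v) \<Prod>\<^sub>u f\<^sub>k(\<mu>\<^sub>u) \<le> \<Prod>\<^sub>u f\<^sub>k\<^sub>-\<^sub>1(\<mu>\<^sub>u) + \<lambda>\<^sub>v\<close> over the \<open>m - 1\<close> neighbours \<open>u\<close> of \<open>v\<close>, where \<open>k = d\<^sub>u + 1 \<le> m\<close>.
  It follows from the one-variable inequality
  \<open>1/m + (m-1)/m f\<^sub>k(x)\<^bsup>m\<^esup> \<le> f\<^sub>k\<^sub>-\<^sub>1(x)\<^bsup>m-1\<^esup>\<close>, the superadditivity of the geometric mean and a final weighted
  AM-GM. Tracking equality in these three steps forces the neighbours of \<open>v\<close> to carry the weight
  \<open>\<lambda>\<^sub>v\<close> and, if it is nonzero, to have the same degree as \<open>v\<close>.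
\<close>

section \<open>Inequalities for the clique factors\<close>

text \<open>Weighted AM-GM in logarithmic form: add the bounds \<open>ln z \<le> z - 1\<close> at
  \<open>x / M\<close> and \<open>y / M\<close>, whose right-hand sides cancel after weighting. That
  bound is sharp only at \<open>z = 1\<close>, which settles equality.\<close>

lemma ln_convex_combination:
  fixes x y t :: real
  assumes "0 < x" "0 < y" "0 < t" "t < 1"
  shows ln_convex_combination_le: "t * ln x + (1 - t) * ln y \<le> ln (t * x + (1 - t) * y)"
    and ln_convex_combination_eqD: "t * ln x + (1 - t) * ln y = ln (t * x + (1 - t) * y) \<Longrightarrow> x = y"
proof -
  define M where "M = t * x + (1 - t) * y"
  have M: "M > 0"
    unfolding M_def using assms by (intro add_pos_pos mult_pos_pos) auto
  have lx: "ln (x / M) = ln x - ln M" and ly: "ln (y / M) = ln y - ln M"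
    using assms M by (simp_all add: ln_div)
  have bx: "ln (x / M) \<le> x / M - 1" and bdy: "ln (y / M) \<le> y / M - 1"
    using assms M by (simp_all add: ln_le_minus_one)
  have sum: "t * (x / M - 1) + (1 - t) * (y / M - 1) = 0"
    using M by (simp add: field_simps) (simp add: M_def algebra_simps)
  have tx: "t * ln (x / M) \<le> t * (x / M - 1)" and ty: "(1 - t) * ln (y / M) \<le> (1 - t) * (y / M - 1)"
    using bx bdy assms by (simp_all add: mult_left_mono)
  have gap: "t * ln x + (1 - t) * ln y - ln M = t * ln (x / M) + (1 - t) * ln (y / M)"
    unfolding lx ly by (simp add: algebra_simps)
  show "t * ln x + (1 - t) * ln y \<le> ln (t * x + (1 - t) * y)"
    using gap tx ty sum unfolding M_def by linarith
  assume "t * ln x + (1 - t) * ln y = ln (t * x + (1 - t) * y)"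
  then have "t * ln (x / M) + (1 - t) * ln (y / M) = 0"
    using gap unfolding M_def by linarith
  then have "t * ln (x / M) = t * (x / M - 1)" "(1 - t) * ln (y / M) = (1 - t) * (y / M - 1)"
    using tx ty sum by linarith+
  then have "ln (x / M) = x / M - 1" "ln (y / M) = y / M - 1"
    using assms by simp_all
  then have "x / M = 1" "y / M = 1"
    using assms M ln_eq_minus_one[of "x / M"] ln_eq_minus_one[of "y / M"] by auto
  then show "x = y"
    using M by simp
qed

section \<open>Logarithms of the clique factors\<close>

text \<open>The logarithm of the factor f_m(x) = (1 + m x)^(1/m), so that products over vertices
  become sums.\<close>

definition clique_log :: "nat \<Rightarrow> real \<Rightarrow> real" where
  "clique_log m x = ln (1 + real m * x) / real m"

lemma exp_mult_clique_log:
  assumes "0 < m" "0 \<le> x"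
  shows "exp (real m * clique_log m x) = 1 + real m * x"
proof -
  have "0 < 1 + real m * x"
    using assms by (simp add: add_pos_nonneg)
  then show ?thesis
    using assms by (simp add: clique_log_def)
qed

text \<open>\<open>1 + k x\<close> is the convex combination of \<open>1 + m x\<close> and 1 with
  weight \<open>k / m\<close>, so strict concavity of the logarithm applies.\<close>

lemma clique_log_strict_antimono:
  assumes "0 < k" "k < m" "0 < x"
  shows "clique_log m x < clique_log k x"
proof -
  define t where "t = real k / real m"
  have t: "0 < t" "t < 1"
    using assms by (simp_all add: t_def)
  have mt: "t * (1 + real m * x) + (1 - t) * 1 = 1 + real k * x"
    using assms by (simp add: t_def field_simps)
  have "t * ln (1 + real m * x) \<le> ln (1 + real k * x)"
    using ln_convex_combination_le[of "1 + real m * x" 1 t] assms t unfolding mt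
    by (simp add: add_pos_pos)
  moreover have "t * ln (1 + real m * x) \<noteq> ln (1 + real k * x)"
    using ln_convex_combination_eqD[of "1 + real m * x" 1 t] assms t unfolding mt
    by (auto simp: add_pos_pos)
  ultimately have "t * ln (1 + real m * x) < ln (1 + real k * x)"
    by simp
  then show ?thesis
    using assms by (simp add: clique_log_def t_def field_simps)
qed

lemma clique_log_0 [simp]: "clique_log m 0 = 0"
  by (simp add: clique_log_def)

lemma clique_log_antimono:
  assumes "0 < k" "k \<le> m" "0 \<le> x"
  shows "clique_log m x \<le> clique_log k x"
  using clique_log_strict_antimono[of k m x] assms by (cases "k = m"; cases "x = 0") auto

lemma clique_log_eqD:
  assumes "clique_log m x = clique_log k x" "0 < k" "k \<le> m" "0 \<le> x"
  shows "x = 0 \<or> k = m"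
  using clique_log_strict_antimono[of k m x] assms by force

lemma has_real_derivative_clique_log:
  assumes "0 < m" "0 \<le> x"
  shows "(clique_log m has_real_derivative 1 / (1 + real m * x)) (at x)"
proof -
  have "0 < 1 + real m * x"
    using assms by (simp add: add_pos_nonneg)
  then show ?thesis
    unfolding clique_log_def[abs_def] using assms
    by (auto intro!: derivative_eq_intros)
qed

section \<open>The one-variable inequality\<close>

text \<open>The difference \<open>F\<close> of the two powers equals 1 at 0 and has a positive
  derivative, because f_(j+1) < f_j.\<close>

lemma clique_power_compare_strict:
  assumes "0 < j" "j < n" "0 < x"
  shows "1 + real n * exp (real (Suc n) * clique_log (Suc j) x)
    < real (Suc n) * exp (real n * clique_log j x)"
proof -
  define F where "F y = real (Suc n) * exp (real n * clique_log j y)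
    - real n * exp (real (Suc n) * clique_log (Suc j) y)" for y
  define F' where "F' y = real (Suc n) * real n *
    (exp (real n * clique_log j y) / (1 + real j * y)
      - exp (real (Suc n) * clique_log (Suc j) y) / (1 + real (Suc j) * y))" for y
  have deriv: "(F has_real_derivative F' y) (at y)" if "0 \<le> y" for y
    unfolding F_def F'_def using assms that
    by (auto intro!: derivative_eq_intros has_real_derivative_clique_log
        simp: algebra_simps simp del: of_nat_Suc)
  have pos: "0 < F' y" if y: "0 < y" for y
  proof -
    \<comment> \<open>Since f_j^j = 1 + j y, the division lowers the exponent \<open>n\<close> to
      \<open>n - j\<close>. The second division lowers \<open>n + 1\<close> to the same exponent,
      which is positive by \<open>j < n\<close>.\<close>
    have "exp (real n * clique_log j y) / (1 + real j * y) = exp ((real n - real j) * clique_log j y)"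
      using exp_mult_clique_log[of j y] assms y by (simp add: left_diff_distrib exp_diff)
    moreover have "exp (real (Suc n) * clique_log (Suc j) y) / (1 + real (Suc j) * y)
        = exp ((real (Suc n) - real (Suc j)) * clique_log (Suc j) y)"
      using exp_mult_clique_log[of "Suc j" y] assms y
      by (simp add: left_diff_distrib exp_diff del: of_nat_Suc)
    ultimately show ?thesis
      unfolding F'_def using clique_log_strict_antimono[of j "Suc j" y] assms y by simp
  qed
  have "F 0 < F x"
  \<comment> \<open>\<open>F'\<close> vanishes at 0, so positivity holds only on the open
    interval.\<close>
  proof (rule DERIV_pos_imp_increasing_open[OF \<open>0 < x\<close>])
    show "\<exists>d. (F has_real_derivative d) (at y) \<and> d > 0" if "0 < y" "y < x" for y
      using deriv[of y] pos[of y] that by auto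
    show "continuous_on {0..x} F"
      by (intro continuous_at_imp_continuous_on ballI DERIV_isCont[OF deriv]) simp
  qed
  then show ?thesis
    by (simp add: F_def)
qed

text \<open>At \<open>j = n\<close> both sides equal \<open>(n + 1) (1 + n x)\<close> for every
  \<open>x\<close>, hence the second alternative in the equality case.\<close>

lemma clique_power_compare:
  assumes "0 < j" "j \<le> n" "0 \<le> x"
  shows clique_power_compare_le: "1 + real n * exp (real (Suc n) * clique_log (Suc j) x)
      \<le> real (Suc n) * exp (real n * clique_log j x)"
    and clique_power_compare_eqD: "1 + real n * exp (real (Suc n) * clique_log (Suc j) x)
      = real (Suc n) * exp (real n * clique_log j x) \<Longrightarrow> x = 0 \<or> j = n"
proof -
  have "1 + real n * exp (real (Suc n) * clique_log (Suc n) x)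
      = real (Suc n) * exp (real n * clique_log n x)"
    using assms exp_mult_clique_log[of n x] exp_mult_clique_log[of "Suc n" x]
    by (simp add: algebra_simps)
  then show "1 + real n * exp (real (Suc n) * clique_log (Suc j) x)
      \<le> real (Suc n) * exp (real n * clique_log j x)"
    using clique_power_compare_strict[of j n x] assms by (cases "x = 0"; cases "j = n") auto
  show "x = 0 \<or> j = n" if "1 + real n * exp (real (Suc n) * clique_log (Suc j) x)
      = real (Suc n) * exp (real n * clique_log j x)"
    using clique_power_compare_strict[of j n x] assms that by force
qed

text \<open>
  The bounds \<open>tangent\<close> below are tangent lines of the convex function \<open>q \<mapsto> ln ((1 + n e\<^sup>q) / (n + 1))\<close>;
  summed at the mean \<open>w\<close> of the \<open>q u\<close> they give the superadditivity of the geometric mean.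
\<close>

lemma star_inequality:
  fixes N :: "'a set" and j :: "'a \<Rightarrow> nat" and mu :: "'a \<Rightarrow> real" and x :: real
  assumes "finite N" and j: "\<And>u. u \<in> N \<Longrightarrow> 0 < j u" "\<And>u. u \<in> N \<Longrightarrow> j u \<le> card N"
    and mu: "\<And>u. u \<in> N \<Longrightarrow> 0 \<le> mu u" and x: "0 \<le> x"
  defines "P \<equiv> \<Sum>u\<in>N. clique_log (j u) (mu u)"
    and "S \<equiv> \<Sum>u\<in>N. clique_log (Suc (j u)) (mu u)"
    and "m \<equiv> Suc (card N)"
  shows star_inequality_le: "exp (clique_log m x + S) \<le> exp P + x"
    and star_inequality_eqD: "exp (clique_log m x + S) = exp P + x \<Longrightarrow> u \<in> N
      \<Longrightarrow> mu u = x \<and> (x = 0 \<or> j u = card N)"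
proof -
  have "exp (clique_log m x + S) \<le> exp P + x \<and> (exp (clique_log m x + S) = exp P + x
    \<longrightarrow> (\<forall>u\<in>N. mu u = x \<and> (x = 0 \<or> j u = card N)))"
  proof (cases "N = {}")
    case True
    then show ?thesis
      using x by (simp add: m_def P_def S_def clique_log_def)
  next
    case False
    define n where "n = real (card N)"
    have n: "1 \<le> n" "real m = n + 1"
      using False \<open>finite N\<close> by (auto simp: n_def m_def Suc_le_eq card_gt_0_iff)
    define q where "q u = (n + 1) * clique_log (Suc (j u)) (mu u)" for u
    \<comment> \<open>The mean of the \<open>q u\<close>: \<open>exp w\<close> is the geometric mean
      of the m-th powers of the factors with index \<open>Suc (j u)\<close>.\<close>
    define w where "w = (n + 1) * S / n"
    define D where "D = (1 + n * exp w) / (n + 1)"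
    \<comment> \<open>The slope at \<open>w\<close>. It is also the weight that makes the tangent
      bound an instance of AM-GM for \<open>exp (q - w)\<close> and 1.\<close>
    define t where "t = n * exp w / (1 + n * exp w)"
    have D: "0 < D" and t: "0 < t" "t < 1"
      using n by (simp_all add: D_def t_def add_pos_pos field_simps)
    have sum_q: "(\<Sum>u\<in>N. q u) = n * w"
      using n by (simp add: q_def w_def S_def flip: sum_distrib_left)
    have tangent_eq: "t * exp (q - w) + (1 - t) * 1 = (1 + n * exp q) / (n + 1) / D" for q
    proof -
      have "0 < 1 + n * exp w"
        using n by (simp add: add_pos_pos)
      moreover have "t * exp (q - w) = n * exp q / (1 + n * exp w)"
        by (simp add: t_def exp_diff)
      ultimately show ?thesis
        using n by (simp add: t_def D_def divide_simps)
    qed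
    have ln_quot: "ln ((1 + n * exp q) / (n + 1) / D) = ln ((1 + n * exp q) / (n + 1)) - ln D" for q
    proof -
      have "0 < (1 + n * exp q) / (n + 1)"
        using n by (intro divide_pos_pos add_pos_pos) auto
      then show ?thesis
        using D by (rule ln_divide_pos)
    qed
    have tangent: "ln D + t * (q - w) \<le> ln ((1 + n * exp q) / (n + 1))" for q
      using ln_convex_combination_le[of "exp (q - w)" 1 t] t
      unfolding tangent_eq ln_quot by simp
    have tangent_eqD: "q = w" if "ln D + t * (q - w) = ln ((1 + n * exp q) / (n + 1))" for q
      using ln_convex_combination_eqD[of "exp (q - w)" 1 t] t that
      unfolding tangent_eq ln_quot by simp
    have one: "(1 + n * exp (q u)) / (n + 1) \<le> exp (n * clique_log (j u) (mu u))" if "u \<in> N" for u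
      using clique_power_compare_le[of "j u" "card N" "mu u"] j mu that n
      by (simp add: n_def q_def field_simps add.commute)
    have one_eqD: "mu u = 0 \<or> j u = card N"
      if "u \<in> N" "(1 + n * exp (q u)) / (n + 1) = exp (n * clique_log (j u) (mu u))" for u
      using clique_power_compare_eqD[of "j u" "card N" "mu u"] j mu that n
      by (simp add: n_def q_def field_simps add.commute)
    have ln_one: "ln ((1 + n * exp (q u)) / (n + 1)) \<le> n * clique_log (j u) (mu u)" if "u \<in> N" for u
    proof -
      have "0 < (1 + n * exp (q u)) / (n + 1)"
        using n by (intro divide_pos_pos add_pos_pos) auto
      then show ?thesis
        using ln_mono[OF one[OF that]] by simp
    qed
    have local_le: "ln D + t * (q u - w) \<le> n * clique_log (j u) (mu u)" if "u \<in> N" for u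
      using tangent[of "q u"] ln_one[OF that] by linarith
    \<comment> \<open>The terms \<open>t * (q u - w)\<close> add up to 0 because \<open>w\<close> is
      the mean.\<close>
    have sum_left: "(\<Sum>u\<in>N. ln D + t * (q u - w)) = n * ln D"
      by (simp add: sum.distrib sum_q sum_subtractf flip: sum_distrib_left n_def)
    have sum_right: "(\<Sum>u\<in>N. n * clique_log (j u) (mu u)) = n * P"
      by (simp add: P_def sum_distrib_left)
    have "n * ln D \<le> n * P"
      using sum_mono[of N "\<lambda>u. ln D + t * (q u - w)", OF local_le] sum_left sum_right by simp
    then have P: "ln D \<le> P"
      using n by simp
    then have DP: "D \<le> exp P"
      using D by (metis exp_le_cancel_iff exp_ln)
    \<comment> \<open>The final AM-GM puts weight 1/m on \<open>1 + m x\<close> and the rest on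
      \<open>exp w\<close>: the arithmetic mean is \<open>D + x\<close>, the mean of the logarithms
      is \<open>clique_log m x + S\<close>.\<close>
    define s where "s = 1 / (n + 1)"
    have s: "0 < s" "s < 1"
      using n by (simp_all add: s_def)
    have pos: "0 < 1 + real m * x"
      using x by (simp add: add_pos_nonneg)
    have mean: "s * (1 + real m * x) + (1 - s) * exp w = D + x"
    proof -
      have 1: "s * (n + 1) = 1" and 2: "1 - s = s * n" and 3: "D = s * (1 + n * exp w)"
        using n by (simp_all add: s_def D_def field_simps)
      have "s * (1 + (n + 1) * x) = s + s * (n + 1) * x"
        by (simp add: algebra_simps)
      then show ?thesis
        unfolding n(2) 1 2 3 by (simp add: algebra_simps)
    qed
    have logs: "s * ln (1 + real m * x) + (1 - s) * ln (exp w) = clique_log m x + S"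
    proof -
      have "1 - s = n / (n + 1)"
        using n by (simp add: s_def field_simps)
      then have "(1 - s) * w = S"
        using n by (simp add: w_def)
      then show ?thesis
        using n by (simp add: s_def clique_log_def)
    qed
    have Dx: "0 < D + x"
      using D x by simp
    have "clique_log m x + S \<le> ln (D + x)"
      using ln_convex_combination_le[of "1 + real m * x" "exp w" s] pos s mean logs by simp
    then have top: "exp (clique_log m x + S) \<le> D + x"
      using Dx by (simp add: ln_ge_iff)
    have "mu u = x \<and> (x = 0 \<or> j u = card N)"
      if eq: "exp (clique_log m x + S) = exp P + x" and u: "u \<in> N" for u
    proof -
      \<comment> \<open>Both inequalities in
        \<open>exp (clique_log m x + S) \<le> D + x \<le> exp P + x\<close> are now equalities. The
        second forces every local bound to be sharp, in its tangent part and in its one-variable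
        part.\<close>
      have "exp P = D" and top_eq: "exp (clique_log m x + S) = D + x"
        using eq top DP by linarith+
      then have "P = ln D"
        using ln_exp[of P] by simp
      then have "(\<Sum>u\<in>N. ln D + t * (q u - w)) = (\<Sum>u\<in>N. n * clique_log (j u) (mu u))"
        using sum_left sum_right by simp
      then have "ln D + t * (q u - w) = n * clique_log (j u) (mu u)"
        by (rule sum_mono_inv) (use local_le u \<open>finite N\<close> in auto)
      then have e1: "ln D + t * (q u - w) = ln ((1 + n * exp (q u)) / (n + 1))"
        and e2: "ln ((1 + n * exp (q u)) / (n + 1)) = n * clique_log (j u) (mu u)"
        using tangent[of "q u"] ln_one[OF u] by linarith+
      have "(1 + n * exp (q u)) / (n + 1) = exp (n * clique_log (j u) (mu u))"
        unfolding e2[symmetric] using n by (simp add: add_pos_pos)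
      then have mj: "mu u = 0 \<or> j u = card N"
        using one_eqD u by blast
      have "clique_log m x + S = ln (D + x)"
        using top_eq by (metis ln_exp)
      then have "1 + real m * x = exp w"
        using ln_convex_combination_eqD[of "1 + real m * x" "exp w" s] pos s mean logs by simp
      also have "\<dots> = exp (q u)"
        using tangent_eqD[OF e1] by simp
      finally have q: "exp (q u) = 1 + real m * x" ..
      \<comment> \<open>If \<open>mu u = 0\<close>, then \<open>q u = 0\<close> and so
        \<open>x = 0\<close>; if \<open>j u = card N\<close>, then \<open>exp (q u)\<close> is also
        \<open>1 + m * mu u\<close>.\<close>
      show ?thesis
        using mj
      proof
        assume "mu u = 0"
        then show ?thesis
          using q n by (simp add: q_def)
      next
        assume ju: "j u = card N"
        then have "exp (q u) = 1 + real m * mu u"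
          using exp_mult_clique_log[of m "mu u"] mu[OF u] n by (simp add: q_def m_def add.commute)
        then show ?thesis
          using q n ju by simp
      qed
    qed
    then show ?thesis
      using top DP by auto
  qed
  then show "exp (clique_log m x + S) \<le> exp P + x"
    and "exp (clique_log m x + S) = exp P + x \<Longrightarrow> u \<in> N \<Longrightarrow> mu u = x \<and> (x = 0 \<or> j u = card N)"
    by blast+
qed

section \<open>Vertex deletion\<close>

text \<open>
  The induction keeps the edge relation \<open>E\<close> fixed and shrinks the vertex set \<open>V\<close>; edges of \<open>E\<close>
  leaving \<open>V\<close> are ignored.
\<close>

definition nbrs :: "('a \<times> 'a) set \<Rightarrow> 'a set \<Rightarrow> 'a \<Rightarrow> 'a set" where
  "nbrs E V v = {u \<in> V. (v, u) \<in> E}"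

definition ipoly :: "('a \<times> 'a) set \<Rightarrow> ('a \<Rightarrow> real) \<Rightarrow> 'a set \<Rightarrow> real" where
  "ipoly E l V = (\<Sum>I | I \<subseteq> V \<and> (\<forall>u\<in>I. \<forall>v\<in>I. (u, v) \<notin> E). \<Prod>v\<in>I. l v)"

text \<open>The logarithm of the product on the right of the theorem, with degrees taken inside
  \<open>V\<close>.\<close>

definition clique_bound :: "('a \<times> 'a) set \<Rightarrow> ('a \<Rightarrow> real) \<Rightarrow> 'a set \<Rightarrow> real" where
  "clique_bound E l V = (\<Sum>v\<in>V. clique_log (Suc (card (nbrs E V v))) (l v))"

text \<open>
  A form of the equality condition that is local to the edges, hence easy to pass to and from
  vertex-deleted subgraphs.
\<close>

definition tight :: "('a \<times> 'a) set \<Rightarrow> ('a \<Rightarrow> real) \<Rightarrow> 'a set \<Rightarrow> bool" where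
  "tight E l V \<longleftrightarrow> (\<forall>u\<in>V. \<forall>v\<in>nbrs E V u. l u = l v
    \<and> (l u = 0 \<or> insert u (nbrs E V u) = insert v (nbrs E V v)))"

lemma finite_nbrs [simp]: "finite V \<Longrightarrow> finite (nbrs E V v)"
  by (simp add: nbrs_def)

lemma nbrs_mono: "U \<subseteq> V \<Longrightarrow> nbrs E U v \<subseteq> nbrs E V v"
  by (auto simp: nbrs_def)

text \<open>Split the independent sets by whether they contain \<open>v\<close>; removing
  \<open>v\<close> from those that do leaves the independent sets outside its closed
  neighbourhood.\<close>

lemma ipoly_rec:
  assumes "finite V" and v: "v \<in> V" and "sym E" "irrefl E"
  shows "ipoly E l V = ipoly E l (V - {v}) + l v * ipoly E l (V - {v} - nbrs E V v)"
proof -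
  define ind where "ind U = {I. I \<subseteq> U \<and> (\<forall>u\<in>I. \<forall>v\<in>I. (u, v) \<notin> E)}" for U
  let ?R = "V - {v} - nbrs E V v"
  have fin: "finite (ind U)" if "finite U" for U
    using that by (rule_tac finite_subset[of _ "Pow U"]) (auto simp: ind_def)
  have split: "ind V = ind (V - {v}) \<union> insert v ` ind ?R"
  proof (intro equalityI subsetI)
    fix I assume I: "I \<in> ind V"
    show "I \<in> ind (V - {v}) \<union> insert v ` ind ?R"
    proof (cases "v \<in> I")
      case True
      then have "I - {v} \<in> ind ?R" "I = insert v (I - {v})"
        using I by (auto simp: ind_def nbrs_def)
      then show ?thesis by blast
    next
      case False
      then show ?thesis using I by (auto simp: ind_def)
    qed
  next
    fix I assume "I \<in> ind (V - {v}) \<union> insert v ` ind ?R"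
    moreover have "insert v J \<in> ind V" if "J \<in> ind ?R" for J
    proof -
      have "(v, u) \<notin> E" "(u, v) \<notin> E" if "u \<in> J" for u
      proof -
        show "(v, u) \<notin> E"
          using \<open>J \<in> ind ?R\<close> that by (auto simp: ind_def nbrs_def)
        then show "(u, v) \<notin> E"
          using symD[OF \<open>sym E\<close>, of u v] by blast
      qed
      moreover have "(v, v) \<notin> E"
        using \<open>irrefl E\<close> by (simp add: irrefl_def)
      ultimately show ?thesis
        using that v by (auto simp: ind_def)
    qed
    moreover have "ind (V - {v}) \<subseteq> ind V"
      by (auto simp: ind_def)
    ultimately show "I \<in> ind V"
      by blast
  qed
  have "(\<Sum>I\<in>insert v ` ind ?R. \<Prod>u\<in>I. l u) = (\<Sum>J\<in>ind ?R. \<Prod>u\<in>insert v J. l u)"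
    by (rule sum.reindex_cong[of "insert v"]) (auto simp: inj_on_def ind_def insert_ident)
  also have "\<dots> = (\<Sum>J\<in>ind ?R. l v * (\<Prod>u\<in>J. l u))"
  proof (rule sum.cong[OF refl])
    fix J assume "J \<in> ind ?R"
    then have "v \<notin> J" "finite J"
      using \<open>finite V\<close> by (auto simp: ind_def intro: finite_subset)
    then show "(\<Prod>u\<in>insert v J. l u) = l v * (\<Prod>u\<in>J. l u)"
      by simp
  qed
  finally have ins: "(\<Sum>I\<in>insert v ` ind ?R. \<Prod>u\<in>I. l u) = l v * (\<Sum>J\<in>ind ?R. \<Prod>u\<in>J. l u)"
    by (simp add: sum_distrib_left)
  have "(\<Sum>I\<in>ind V. \<Prod>u\<in>I. l u)
      = (\<Sum>I\<in>ind (V - {v}). \<Prod>u\<in>I. l u) + (\<Sum>I\<in>insert v ` ind ?R. \<Prod>u\<in>I. l u)"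
    unfolding split using fin \<open>finite V\<close> by (intro sum.union_disjoint) (auto simp: ind_def)
  then show ?thesis
    unfolding ins unfolding ipoly_def ind_def .
qed

lemma ipoly_empty [simp]: "ipoly E l {} = 1"
proof -
  have "{I. I \<subseteq> {} \<and> (\<forall>u\<in>I. \<forall>v\<in>I. (u, v) \<notin> E)} = {{}}"
    by auto
  then show ?thesis
    by (simp add: ipoly_def)
qed

section \<open>Effect of deleting a vertex on the bound\<close>

context
  fixes E :: "('a \<times> 'a) set" and l :: "'a \<Rightarrow> real" and V :: "'a set" and v :: 'a
  assumes fin: "finite V" and v: "v \<in> V" and sym: "sym E" and irrefl: "irrefl E"
    and nonneg: "\<forall>u\<in>V. 0 \<le> l u"
begin

lemma sum_delete_vertex:
  fixes f :: "'a \<Rightarrow> real"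
  shows sum_vertex_split: "sum f V = f v + sum f (nbrs E V v) + sum f (V - {v} - nbrs E V v)"
    and sum_delete_split: "sum f (V - {v}) = sum f (nbrs E V v) + sum f (V - {v} - nbrs E V v)"
proof -
  have sub: "nbrs E V v \<subseteq> V - {v}"
    using irrefl by (auto simp: nbrs_def irrefl_def)
  show del: "sum f (V - {v}) = sum f (nbrs E V v) + sum f (V - {v} - nbrs E V v)"
    using sum.subset_diff[OF sub, of f] fin by simp
  show "sum f V = f v + sum f (nbrs E V v) + sum f (V - {v} - nbrs E V v)"
    using sum.remove[OF fin v, of f] del by simp
qed

lemma nbrs_delete_neighbour:
  assumes "u \<in> nbrs E V v"
  shows "Suc (card (nbrs E (V - {v}) u)) = card (nbrs E V u)"
proof -
  have "v \<in> nbrs E V u" "nbrs E (V - {v}) u = nbrs E V u - {v}"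
    using assms sym v by (auto simp: nbrs_def dest: symD)
  then show ?thesis
    using fin card_Suc_Diff1[of "nbrs E V u" v] by simp
qed

lemma nbrs_delete_nonneighbour:
  assumes "w \<in> V - {v} - nbrs E V v"
  shows "nbrs E (V - {v}) w = nbrs E V w"
  using assms sym by (auto simp: nbrs_def dest: symD)

text \<open>Each neighbour of \<open>v\<close> loses exactly one from its degree, so its index drops
  by one; the remaining terms are the same as in \<open>clique_bound_split\<close>.\<close>

lemma clique_bound_delete:
  "clique_bound E l (V - {v}) = (\<Sum>u\<in>nbrs E V v. clique_log (card (nbrs E V u)) (l u))
    + (\<Sum>w\<in>V - {v} - nbrs E V v. clique_log (Suc (card (nbrs E V w))) (l w))"
  unfolding clique_bound_def sum_delete_split
  by (intro arg_cong2[where f = "(+)"] sum.cong refl)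
    (simp_all only: nbrs_delete_neighbour nbrs_delete_nonneighbour)

lemma clique_bound_split:
  "clique_bound E l V = clique_log (Suc (card (nbrs E V v))) (l v)
    + (\<Sum>u\<in>nbrs E V v. clique_log (Suc (card (nbrs E V u))) (l u))
    + (\<Sum>w\<in>V - {v} - nbrs E V v. clique_log (Suc (card (nbrs E V w))) (l w))"
  unfolding clique_bound_def by (rule sum_vertex_split)

text \<open>Degrees can only fall, and the factors are antitone in the index. Equality makes
  vertices of nonzero weight keep their degree, hence, neighbourhoods being nested, their whole
  neighbourhood.\<close>

lemma clique_bound_delete_closed:
  shows clique_bound_delete_closed_ge:
    "(\<Sum>w\<in>V - {v} - nbrs E V v. clique_log (Suc (card (nbrs E V w))) (l w))
      \<le> clique_bound E l (V - {v} - nbrs E V v)"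
    and clique_bound_delete_closed_eqD:
    "(\<Sum>w\<in>V - {v} - nbrs E V v. clique_log (Suc (card (nbrs E V w))) (l w))
      = clique_bound E l (V - {v} - nbrs E V v) \<Longrightarrow> w \<in> V - {v} - nbrs E V v \<Longrightarrow> l w \<noteq> 0
      \<Longrightarrow> nbrs E (V - {v} - nbrs E V v) w = nbrs E V w"
proof -
  let ?R = "V - {v} - nbrs E V v"
  have card_le: "card (nbrs E ?R w) \<le> card (nbrs E V w)" for w
    using fin by (intro card_mono nbrs_mono) auto
  have le: "clique_log (Suc (card (nbrs E V w))) (l w) \<le> clique_log (Suc (card (nbrs E ?R w))) (l w)"
    if "w \<in> ?R" for w
    using nonneg card_le that by (intro clique_log_antimono) auto
  then show "(\<Sum>w\<in>?R. clique_log (Suc (card (nbrs E V w))) (l w)) \<le> clique_bound E l ?R"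
    unfolding clique_bound_def by (rule sum_mono)
  assume eq: "(\<Sum>w\<in>?R. clique_log (Suc (card (nbrs E V w))) (l w)) = clique_bound E l ?R"
    and w: "w \<in> ?R" "l w \<noteq> 0"
  have "clique_log (Suc (card (nbrs E V w))) (l w) = clique_log (Suc (card (nbrs E ?R w))) (l w)"
    using sum_mono_inv[OF eq[unfolded clique_bound_def] le w(1)] fin by simp
  then have "card (nbrs E ?R w) = card (nbrs E V w)"
    using clique_log_eqD[of "Suc (card (nbrs E V w))" "l w" "Suc (card (nbrs E ?R w))"]
      w nonneg card_le[of w] by auto
  then show "nbrs E ?R w = nbrs E V w"
    using fin by (intro card_subset_eq nbrs_mono) auto
qed

end

section \<open>Sufficiency of tightness\<close>

text \<open>Closed neighbourhoods in \<open>U\<close> are the traces on \<open>U\<close> of those in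
  \<open>V\<close>, so their coincidence is inherited.\<close>

lemma tight_subset:
  assumes "tight E l V" "U \<subseteq> V"
  shows "tight E l U"
  unfolding tight_def
proof (intro ballI)
  fix u w assume "u \<in> U" and w: "w \<in> nbrs E U u"
  then have *: "l u = l w \<and> (l u = 0 \<or> insert u (nbrs E V u) = insert w (nbrs E V w))"
    using assms nbrs_mono[of U V E u] unfolding tight_def by blast
  moreover have "insert x (nbrs E U x) = insert x (nbrs E V x) \<inter> U" if "x \<in> U" for x
    using assms that by (auto simp: nbrs_def)
  moreover have "u \<in> U" "w \<in> U"
    using \<open>u \<in> U\<close> w by (auto simp: nbrs_def)
  ultimately show "l u = l w \<and> (l u = 0 \<or> insert u (nbrs E U u) = insert w (nbrs E U w))"
    by auto
qed

text \<open>Delete an arbitrary vertex \<open>v\<close>. If its weight is 0, so are those of its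
  neighbours, and their factors are all 1. Otherwise its closed neighbourhood is a clique cut off
  from the rest, and the recursion reads (1 + n x) + x = 1 + (n + 1) x.\<close>

lemma ipoly_eq_if_tight:
  assumes "finite V" "sym E" "irrefl E" "\<forall>u\<in>V. 0 \<le> l u" "tight E l V"
  shows "ipoly E l V = exp (clique_bound E l V)"
  using assms(1,4,5)
proof (induction "card V" arbitrary: V rule: less_induct)
  case less
  show ?case
  proof (cases "V = {}")
    case True
    then show ?thesis
      by (simp add: clique_bound_def)
  next
    case False
    then obtain v where v: "v \<in> V"
      by blast
    note ctx = \<open>finite V\<close> v assms(2,3) less.prems(2)
    define N where "N = nbrs E V v"
    define R where "R = V - {v} - N"
    define rho where "rho = (\<Sum>w\<in>R. clique_log (Suc (card (nbrs E V w))) (l w))"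
    have sub: "V - {v} \<subset> V" "R \<subset> V"
      using v by (auto simp: R_def)
    have IH: "ipoly E l U = exp (clique_bound E l U)" if "U \<subset> V" for U
      using that less.prems tight_subset[of E l V U]
      by (intro less.hyps) (auto intro: psubset_card_mono finite_subset)
    have rec: "ipoly E l V = exp (clique_bound E l (V - {v})) + l v * exp (clique_bound E l R)"
      using ipoly_rec[OF ctx(1-4), of l] IH[OF sub(1)] IH[OF sub(2)] by (simp add: R_def N_def)
    have del: "clique_bound E l (V - {v}) = (\<Sum>u\<in>N. clique_log (card (nbrs E V u)) (l u)) + rho"
      unfolding N_def R_def rho_def using ctx by (rule clique_bound_delete)
    have all: "clique_bound E l V = clique_log (Suc (card N)) (l v)
        + (\<Sum>u\<in>N. clique_log (Suc (card (nbrs E V u))) (l u)) + rho"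
      unfolding N_def R_def rho_def using ctx by (rule clique_bound_split)
    have lN: "l u = l v" if "u \<in> N" for u
      using less.prems(3) v that by (auto simp: tight_def N_def)
    show ?thesis
    proof (cases "l v = 0")
      case True
      then show ?thesis
        using rec del all lN by simp
    next
      case False
      then have pos: "0 < l v"
        using less.prems(2) v by (simp add: less_le)
      have closed: "insert u (nbrs E V u) = insert v N" if "u \<in> N" for u
        using less.prems(3) v that False unfolding tight_def N_def by metis
      have fin: "finite N"
        using \<open>finite V\<close> by (simp add: N_def)
      have irr: "u \<notin> nbrs E V u" for u
        using \<open>irrefl E\<close> by (simp add: nbrs_def irrefl_def)
      have deg: "card (nbrs E V u) = card N" if "u \<in> N" for u
      proof -
        have "Suc (card (nbrs E V u)) = Suc (card N)"
          using closed[OF that] irr[of u] irr[of v] fin \<open>finite V\<close>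
          by (metis N_def card_insert_disjoint finite_nbrs)
        then show ?thesis by simp
      qed
      have "nbrs E R w = nbrs E V w" if "w \<in> R" for w
      proof -
        \<comment> \<open>Every neighbour of a vertex of the closed neighbourhood of
          \<open>v\<close> lies in it again, so no edge leads to \<open>R\<close>.\<close>
        have "u \<notin> nbrs E V w" if "u = v \<or> u \<in> N" for u
        proof
          assume "u \<in> nbrs E V w"
          then have "w \<in> nbrs E V u"
            using \<open>w \<in> R\<close> \<open>sym E\<close> by (auto simp: nbrs_def R_def dest: symD)
          then have "w \<in> insert v N"
            using closed[of u] that by (auto simp: N_def)
          then show False
            using \<open>w \<in> R\<close> by (simp add: R_def)
        qed
        then show ?thesis
          by (auto simp: R_def nbrs_def)
      qed
      then have bR: "clique_bound E l R = rho"
        unfolding clique_bound_def rho_def by simp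
      have bN: "(\<Sum>u\<in>N. clique_log (card (nbrs E V u)) (l u)) = card N * clique_log (card N) (l v)"
        "(\<Sum>u\<in>N. clique_log (Suc (card (nbrs E V u))) (l u)) = card N * clique_log (Suc (card N)) (l v)"
        by (simp_all add: deg lN)
      have "exp (card N * clique_log (card N) (l v)) = 1 + card N * l v"
        using exp_mult_clique_log[of "card N" "l v"] pos by (cases "card N = 0") auto
      moreover have "exp (clique_log (Suc (card N)) (l v) + card N * clique_log (Suc (card N)) (l v))
          = 1 + Suc (card N) * l v"
        using exp_mult_clique_log[of "Suc (card N)" "l v"] pos by (simp add: algebra_simps)
      ultimately show ?thesis
        unfolding rec del all bR bN by (simp add: exp_add algebra_simps)
    qed
  qed
qed

section \<open>The inequality and necessity of tightness\<close>

text \<open>Both claims share one induction: the equality case for \<open>V\<close> starts from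
  tightness of \<open>V - {v}\<close>, and uses the bound for \<open>R\<close> as well.\<close>

lemma clique_bound_le_ipoly:
  assumes "finite V" "sym E" "irrefl E" "\<forall>u\<in>V. 0 \<le> l u"
  shows "exp (clique_bound E l V) \<le> ipoly E l V
    \<and> (ipoly E l V = exp (clique_bound E l V) \<longrightarrow> tight E l V)"
  using assms(1,4)
proof (induction "card V" arbitrary: V rule: less_induct)
  case less
  show ?case
  proof (cases "V = {}")
    case True
    then show ?thesis
      by (simp add: clique_bound_def tight_def)
  next
    case False
    define deg where "deg w = card (nbrs E V w)" for w
    \<comment> \<open>Maximality supplies the hypothesis \<open>j u \<le> card N\<close> of
      \<open>star_inequality\<close>.\<close>
    obtain v where v: "v \<in> V" and max: "\<And>w. w \<in> V \<Longrightarrow> deg w \<le> deg v"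
    proof -
      have "finite (deg ` V)" "deg ` V \<noteq> {}"
        using False \<open>finite V\<close> by auto
      from Max_in[OF this] Max_ge[OF this(1)] that show thesis
        by (metis (no_types, lifting) imageE imageI)
    qed
    note ctx = \<open>finite V\<close> v assms(2,3) less.prems(2)
    define N where "N = nbrs E V v"
    define R where "R = V - {v} - N"
    define rho where "rho = (\<Sum>w\<in>R. clique_log (Suc (deg w)) (l w))"
    define P where "P = (\<Sum>u\<in>N. clique_log (deg u) (l u))"
    define S where "S = (\<Sum>u\<in>N. clique_log (Suc (deg u)) (l u))"
    define h where "h = clique_log (Suc (card N)) (l v)"
    have lv: "0 \<le> l v"
      using less.prems(2) v by blast
    have NV: "N \<subseteq> V"
      by (auto simp: N_def nbrs_def)
    have sub: "V - {v} \<subset> V" "R \<subset> V"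
      using v by (auto simp: R_def)
    have IH: "exp (clique_bound E l U) \<le> ipoly E l U
        \<and> (ipoly E l U = exp (clique_bound E l U) \<longrightarrow> tight E l U)" if "U \<subset> V" for U
      using that less.prems
      by (intro less.hyps) (auto intro: psubset_card_mono finite_subset)
    have rec: "ipoly E l V = ipoly E l (V - {v}) + l v * ipoly E l R"
      using ipoly_rec[OF ctx(1-4), of l] by (simp add: R_def N_def)
    have del: "clique_bound E l (V - {v}) = P + rho"
      unfolding N_def R_def rho_def P_def deg_def using ctx by (rule clique_bound_delete)
    have all: "clique_bound E l V = h + S + rho"
      unfolding N_def R_def rho_def S_def h_def deg_def using ctx by (rule clique_bound_split)
    have rho_le: "rho \<le> clique_bound E l R"
      unfolding N_def R_def rho_def deg_def using ctx by (rule clique_bound_delete_closed_ge)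
    have rho_eqD: "nbrs E R w = nbrs E V w" if "rho = clique_bound E l R" "w \<in> R" "l w \<noteq> 0" for w
      using clique_bound_delete_closed_eqD[OF ctx, of w] that unfolding N_def R_def rho_def deg_def
      by simp
    have fN: "finite N"
      using \<open>finite V\<close> by (simp add: N_def)
    have "v \<in> nbrs E V u" if "u \<in> N" for u
      using that v \<open>sym E\<close> by (auto simp: N_def nbrs_def dest: symD)
    then have deg_pos: "0 < deg u" if "u \<in> N" for u
      using that \<open>finite V\<close> by (auto simp: deg_def card_gt_0_iff)
    have deg_le: "deg u \<le> card N" if "u \<in> N" for u
      using max[of u] that NV by (auto simp: deg_def N_def)
    have lN: "0 \<le> l u" if "u \<in> N" for u
      using that NV less.prems(2) by blast
    have star: "exp (h + S) \<le> exp P + l v"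
      unfolding h_def S_def P_def
      by (rule star_inequality_le) (use fN deg_pos deg_le lN lv in auto)
    have star_eqD: "l u = l v \<and> (l v = 0 \<or> deg u = card N)"
      if "exp (h + S) = exp P + l v" "u \<in> N" for u
      using star_inequality_eqD[of N deg l "l v" u] fN deg_pos deg_le lN lv that
      unfolding h_def S_def P_def by blast
    have step1: "exp (P + rho) \<le> ipoly E l (V - {v})"
      using IH[OF sub(1)] del by simp
    have step2: "exp rho \<le> exp (clique_bound E l R)" "exp (clique_bound E l R) \<le> ipoly E l R"
      using IH[OF sub(2)] rho_le by simp_all
    have step2': "l v * exp rho \<le> l v * ipoly E l R"
      using order_trans[OF step2] lv by (rule mult_left_mono)
    have step3: "exp (h + S + rho) \<le> exp (P + rho) + l v * exp rho"
      using mult_right_mono[OF star, of "exp rho"] by (simp add: exp_add algebra_simps)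
    have ineq: "exp (clique_bound E l V) \<le> ipoly E l V"
      unfolding rec all using step1 step2' step3 by linarith
    moreover have "tight E l V" if eq: "ipoly E l V = exp (clique_bound E l V)"
    proof -
      \<comment> \<open>The slacks of \<open>step1\<close>, \<open>step2'\<close> and
        \<open>step3\<close> add up to 0, so each vanishes. The factor \<open>l v\<close> in
        \<open>eq2\<close> may be 0 and is cancelled only later.\<close>
      have eq1: "ipoly E l (V - {v}) = exp (clique_bound E l (V - {v}))"
        and eq2: "l v * exp rho = l v * ipoly E l R"
        and eq3: "exp (h + S + rho) = exp (P + rho) + l v * exp rho"
        using eq step1 step2' step3 unfolding rec all del by linarith+
      have tight': "tight E l (V - {v})"
        using IH[OF sub(1)] eq1 by blast
      have "exp (h + S) * exp rho = (exp P + l v) * exp rho"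
        using eq3 by (simp add: exp_add algebra_simps)
      then have "exp (h + S) = exp P + l v"
        by simp
      note star_eq = star_eqD[OF this]
      have tightD: "l a = l b \<and> (l a = 0 \<or>
          insert a (nbrs E (V - {v}) a) = insert b (nbrs E (V - {v}) b))"
        if "a \<in> V" "b \<in> nbrs E V a" "a \<noteq> v" "b \<noteq> v" for a b
        using tight' that unfolding tight_def by (auto simp: nbrs_def)
      have del_R: "nbrs E (V - {v}) w = nbrs E V w" if "w \<in> R" for w
        using nbrs_delete_nonneighbour[OF ctx, of w] that by (simp add: R_def N_def)
      have closed: "insert u (nbrs E V u) = insert v N" if u: "u \<in> N" and pos: "l v \<noteq> 0" for u
      proof -
        have "exp rho = ipoly E l R"
          using eq2 pos by simp
        then have "exp rho = exp (clique_bound E l R)"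
          using step2 by linarith
        then have rho_eq: "rho = clique_bound E l R"
          by simp
        \<comment> \<open>A neighbour \<open>w\<close> of \<open>u\<close> in \<open>R\<close> would
          have the nonzero weight \<open>l v\<close>, so equality in \<open>rho_le\<close> would
          keep all its neighbours in \<open>R\<close>; but \<open>u\<close> is one of them.\<close>
        have "w \<in> insert v N" if w: "w \<in> nbrs E V u" for w
        proof (rule ccontr)
          assume "w \<notin> insert v N"
          then have wR: "w \<in> R"
            using w by (auto simp: R_def nbrs_def)
          have "u \<noteq> v"
            using u \<open>irrefl E\<close> by (auto simp: N_def nbrs_def irrefl_def)
          then have "l u = l w"
            using tightD[of u w] w wR u NV by (auto simp: R_def)
          then have "l w \<noteq> 0"
            using star_eq[OF u] pos by simp
          then have "nbrs E R w = nbrs E V w"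
            using rho_eqD rho_eq wR by blast
          moreover have "u \<in> nbrs E V w"
            using w u NV \<open>sym E\<close> by (auto simp: nbrs_def dest: symD)
          ultimately have "u \<in> R"
            by (auto simp: nbrs_def)
          then show False
            using u by (simp add: R_def)
        qed
        then have incl: "insert u (nbrs E V u) \<subseteq> insert v N"
          using u by auto
        have "card (insert u (nbrs E V u)) = Suc (deg u)" "card (insert v N) = Suc (card N)"
          using \<open>irrefl E\<close> \<open>finite V\<close> fN by (auto simp: deg_def N_def nbrs_def irrefl_def)
        moreover have "deg u = card N"
          using star_eq[OF u] pos by simp
        ultimately show ?thesis
          using incl fN by (intro card_subset_eq) auto
      qed
      show "tight E l V"
        unfolding tight_def
      proof (intro ballI)
        fix a b assume a: "a \<in> V" and b: "b \<in> nbrs E V a"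
        have bV: "b \<in> V" and ba: "a \<in> nbrs E V b"
          using b a \<open>sym E\<close> by (auto simp: nbrs_def dest: symD)
        have cases: "x = v \<or> x \<in> N \<or> x \<in> R" if "x \<in> V" for x
          using that by (auto simp: R_def)
        have near: "l x = l v" if "x = v \<or> x \<in> N" for x
          using that star_eq by blast
        have near_closed: "insert x (nbrs E V x) = insert v N" if "x = v \<or> x \<in> N" "l v \<noteq> 0" for x
          using that closed by (auto simp: N_def)
        have nbr_near: "y = v \<or> y \<in> N" if "x = v \<or> x \<in> N" "l v \<noteq> 0" "y \<in> nbrs E V x" for x y
        proof -
          have "y \<in> insert v N"
            unfolding near_closed[OF that(1,2), symmetric] using that(3) by (rule insertI2)
          then show ?thesis by blast
        qed
        have l_eq: "l a = l b"
        proof (cases "a = v \<or> b = v")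
          case True
          then have "a = v \<or> a \<in> N" "b = v \<or> b \<in> N"
            using b ba by (auto simp: N_def)
          then show ?thesis
            using near by metis
        next
          case False
          then show ?thesis
            using tightD[OF a b] by blast
        qed
        have "insert a (nbrs E V a) = insert b (nbrs E V b)" if "l a \<noteq> 0"
        \<comment> \<open>An edge of nonzero weight meeting the closed neighbourhood of
          \<open>v\<close> lies inside it, where all closed neighbourhoods agree. Any other edge
          lies in \<open>R\<close>, where deleting \<open>v\<close> changes no
          neighbourhood.\<close>
        proof (cases "(a = v \<or> a \<in> N) \<or> (b = v \<or> b \<in> N)")
          case True
          then have pos: "l v \<noteq> 0"
            using near that l_eq by metis
          then have "a = v \<or> a \<in> N" "b = v \<or> b \<in> N"
            using True nbr_near b ba by blast+
          then show ?thesis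
            using near_closed pos by simp
        next
          case False
          then have "a \<in> R" "b \<in> R"
            using cases a bV by blast+
          then show ?thesis
            using tightD[OF a b] False that del_R by simp
        qed
        then show "l a = l b \<and> (l a = 0 \<or> insert a (nbrs E V a) = insert b (nbrs E V b))"
          using l_eq by blast
      qed
    qed
    ultimately show ?thesis
      by blast
  qed
qed

section \<open>Connected components\<close>

text \<open>Without parallel arcs, the arcs out of \<open>v\<close> are determined by their
  heads.\<close>

lemma (in graph) card_nbrs_eq_out_degree: "card (nbrs (arcs_ends G) (verts G) v) = out_degree G v"
proof -
  have "nbrs (arcs_ends G) (verts G) v = head G ` out_arcs G v"
    by (auto simp: nbrs_def arcs_ends_conv)
  moreover have "inj_on (head G) (out_arcs G v)"
    using no_multi_arcs by (auto simp: inj_on_def arc_to_ends_def)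
  ultimately show ?thesis
    by (simp add: out_degree_def card_image)
qed

text \<open>Carries the edge-local condition along walks; constancy of the weight ensures that the
  same alternative holds at every step.\<close>

lemma (in graph) tight_component_constant:
  assumes tight: "tight (arcs_ends G) l (verts G)" and "u \<rightarrow>\<^sup>* v"
  shows "l v = l u \<and> (l u = 0 \<or>
    insert v (nbrs (arcs_ends G) (verts G) v) = insert u (nbrs (arcs_ends G) (verts G) u))"
  using assms(2)
proof (induction rule: reachable_induct)
  case base
  then show ?case by simp
next
  case (step x y)
  then have "x \<in> verts G" "y \<in> nbrs (arcs_ends G) (verts G) x"
    using adj_in_verts by (auto simp: nbrs_def)
  then have "l x = l y \<and> (l x = 0 \<or>
    insert x (nbrs (arcs_ends G) (verts G) x) = insert y (nbrs (arcs_ends G) (verts G) y))"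
    using tight unfolding tight_def by blast
  then show ?case
    using step.IH by metis
qed

lemma (in graph) arcs_ends_induce_subgraph:
  "arcs_ends (G \<restriction> C) = {(u, v) \<in> arcs_ends G. u \<in> C \<and> v \<in> C}"
  by (auto simp: arcs_ends_conv)

lemma (in graph) complete_digraph_induce_subgraph_iff:
  assumes "C \<subseteq> verts G"
  shows "complete_digraph (card C) (G \<restriction> C) \<longleftrightarrow> (\<forall>u\<in>C. \<forall>v\<in>C. u \<noteq> v \<longrightarrow> u \<rightarrow>\<^bsub>G\<^esub> v)"
proof -
  interpret D: digraph "G \<restriction> C"
    using assms by (intro digraphI_induced induced_induce)
  interpret S: sym_digraph "G \<restriction> C"
    using assms by (intro induced_graph_imp_graph induced_induce)
  have "Digraph.graph (G \<restriction> C)"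
    by unfold_locales
  moreover have "arcs_ends (G \<restriction> C) = {(u, v). (u, v) \<in> C \<times> C \<and> u \<noteq> v}
      \<longleftrightarrow> (\<forall>u\<in>C. \<forall>v\<in>C. u \<noteq> v \<longrightarrow> u \<rightarrow>\<^bsub>G\<^esub> v)"
    unfolding arcs_ends_induce_subgraph using adj_not_same by auto
  ultimately show ?thesis
    by (simp add: complete_digraph_def)
qed

text \<open>Components are closed under adjacency, so in a clique component every closed
  neighbourhood is the whole component. Conversely, equal closed neighbourhoods make any two
  distinct vertices of a component adjacent.\<close>

lemma (in graph) tight_iff_components:
  "tight (arcs_ends G) l (verts G) \<longleftrightarrow> (\<forall>C\<in>sccs_verts. (\<forall>v\<in>C. l v = 0)
    \<or> ((\<exists>c. \<forall>v\<in>C. l v = c) \<and> complete_digraph (card C) (G \<restriction> C)))"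
    (is "?tight \<longleftrightarrow> (\<forall>C\<in>sccs_verts. ?good C)")
proof
  assume tight: ?tight
  show "\<forall>C\<in>sccs_verts. ?good C"
  proof
    fix C assume C: "C \<in> sccs_verts"
    then obtain r where r: "r \<in> C" and reach: "\<And>u v. u \<in> C \<Longrightarrow> v \<in> C \<Longrightarrow> u \<rightarrow>\<^sup>* v"
      by (auto simp: sccs_verts_def)
    have const: "l v = l r" if "v \<in> C" for v
      using tight_component_constant[OF tight reach[OF r that]] by simp
    have "complete_digraph (card C) (G \<restriction> C)" if "l r \<noteq> 0"
      unfolding complete_digraph_induce_subgraph_iff[OF sccs_verts_subsets[OF C]]
    proof (intro ballI impI)
      fix u v assume uv: "u \<in> C" "v \<in> C" "u \<noteq> v"
      have "l u \<noteq> 0"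
        using const[OF uv(1)] that by simp
      moreover have "u \<rightarrow>\<^sup>* v"
        using uv(1,2) by (rule reach)
      note tight_component_constant[OF tight this]
      ultimately have "insert v (nbrs (arcs_ends G) (verts G) v) = insert u (nbrs (arcs_ends G) (verts G) u)"
        by simp
      \<comment> \<open>\<open>v\<close> lies in its own closed neighbourhood, hence in that of
        \<open>u\<close>.\<close>
      from this[THEN equalityD1] have "v \<in> nbrs (arcs_ends G) (verts G) u"
        using uv(3) by simp
      then show "u \<rightarrow>\<^bsub>G\<^esub> v"
        by (simp add: nbrs_def)
    qed
    then show "?good C"
      using const by metis
  qed
next
  assume good: "\<forall>C\<in>sccs_verts. ?good C"
  show ?tight
    unfolding tight_def
  proof (intro ballI)
    fix u v assume u: "u \<in> verts G" and v: "v \<in> nbrs (arcs_ends G) (verts G) u"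
    define C where "C = scc_of u"
    have C: "C \<in> sccs_verts" "u \<in> C"
      using u by (simp_all add: C_def scc_of_in_sccs_verts in_scc_of_self)
    have closed: "y \<in> C" if "x \<in> C" "x \<rightarrow>\<^bsub>G\<^esub> y" for x y
    proof -
      have "u \<rightarrow>\<^sup>* x"
        using that(1) by (simp add: C_def scc_of_def)
      then have "u \<rightarrow>\<^sup>* y"
        using that(2) by (rule reachable_adj_trans)
      then show ?thesis
        unfolding C_def by (rule scc_ofI_reachable')
    qed
    have vC: "v \<in> C"
      using v C(2) closed by (auto simp: nbrs_def)
    have clique: "insert x (nbrs (arcs_ends G) (verts G) x) = C"
      if "complete_digraph (card C) (G \<restriction> C)" "x \<in> C" for x
    proof (intro equalityI subsetI)
      show "y \<in> C" if "y \<in> insert x (nbrs (arcs_ends G) (verts G) x)" for y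
        using that \<open>x \<in> C\<close> closed[of x y] by (auto simp: nbrs_def)
    next
      fix y assume y: "y \<in> C"
      then have "y = x \<or> x \<rightarrow>\<^bsub>G\<^esub> y"
        using \<open>complete_digraph (card C) (G \<restriction> C)\<close> \<open>x \<in> C\<close>
        unfolding complete_digraph_induce_subgraph_iff[OF sccs_verts_subsets[OF C(1)]]
        by metis
      then show "y \<in> insert x (nbrs (arcs_ends G) (verts G) x)"
        using adj_in_verts(2) by (auto simp: nbrs_def)
    qed
    show "l u = l v \<and> (l u = 0 \<or> insert u (nbrs (arcs_ends G) (verts G) u)
        = insert v (nbrs (arcs_ends G) (verts G) v))"
      using good C vC clique by metis
  qed
qed

lemma (in graph) exp_clique_bound_eq_prod:
  assumes "\<forall>v\<in>verts G. 0 \<le> l v"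
  shows "exp (clique_bound (arcs_ends G) l (verts G))
    = (\<Prod>v\<in>verts G. ((real (out_degree G v) + 1) * l v + 1) powr (1 / (real (out_degree G v) + 1)))"
  unfolding clique_bound_def card_nbrs_eq_out_degree exp_sum[OF finite_verts]
proof (rule prod.cong[OF refl])
  fix v assume "v \<in> verts G"
  then have "0 < (real (out_degree G v) + 1) * l v + 1"
    using assms by (simp add: add_nonneg_pos)
  then show "exp (clique_log (Suc (out_degree G v)) (l v))
      = ((real (out_degree G v) + 1) * l v + 1) powr (1 / (real (out_degree G v) + 1))"
    by (simp add: clique_log_def powr_def add.commute)
qed

theorem theorem1p1:
  fixes G :: "('a, 'b) pre_digraph" and l :: "'a \<Rightarrow> real"
  assumes "Digraph.graph G"
    and "\<forall>v\<in>verts G. l v \<ge> 0"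
  shows "indep_poly G l
      \<ge> (\<Prod>v\<in>verts G. indep_poly_univ (complete_graph (out_degree G v + 1)) (l v)
            powr (1 / (real (out_degree G v) + 1)))
    \<and> (\<Prod>v\<in>verts G. indep_poly_univ (complete_graph (out_degree G v + 1)) (l v)
            powr (1 / (real (out_degree G v) + 1)))
      = (\<Prod>v\<in>verts G. ((real (out_degree G v) + 1) * l v + 1)
            powr (1 / (real (out_degree G v) + 1)))
    \<and> (indep_poly G l
        = (\<Prod>v\<in>verts G. indep_poly_univ (complete_graph (out_degree G v + 1)) (l v)
              powr (1 / (real (out_degree G v) + 1)))
      \<longleftrightarrow> (\<forall>C\<in>pre_digraph.sccs_verts G.
            (\<forall>v\<in>C. l v = 0)
          \<or> ((\<exists>c. \<forall>v\<in>C. l v = c) \<and> complete_digraph (card C) (induce_subgraph G C))))"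
proof -
  interpret graph G by (rule assms(1))
  have sym: "sym (arcs_ends G)"
    using sym_arcs by (simp add: symmetric_def)
  have irrefl: "irrefl (arcs_ends G)"
    using adj_not_same by (auto simp: irrefl_def)
  have poly: "indep_poly G l = ipoly (arcs_ends G) l (verts G)"
    by (simp add: indep_poly_def indep_sets_def ipoly_def)
  have cliques: "(\<Prod>v\<in>verts G. indep_poly_univ (complete_graph (out_degree G v + 1)) (l v)
            powr (1 / (real (out_degree G v) + 1)))
      = (\<Prod>v\<in>verts G. ((real (out_degree G v) + 1) * l v + 1)
            powr (1 / (real (out_degree G v) + 1)))"
    by (simp add: indep_poly_univ_complete_graph add.commute)
  show ?thesis
    using clique_bound_le_ipoly[OF finite_verts sym irrefl assms(2)]
      ipoly_eq_if_tight[OF finite_verts sym irrefl assms(2)]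
    unfolding cliques poly exp_clique_bound_eq_prod[OF assms(2)] tight_iff_components[symmetric]
    by blast
qed

end
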